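(* Let $d\ge 2$ and let $C$ be a convex body in the $d$-dimensional Euclidean space $\mathbb{E}^d$. Then $C$ possesses at least one shortest generalized billiard trajectory (i.e. a generalized billiard trajectory of minimal length among all generalized billiard trajectories of $C$, of all periods). Moreover, any shortest generalized billiard trajectory of $C$ is of period at most $d+1$.
   Context: A convex body in $\mathbb{E}^d$ is a compact convex set with non-empty interior. A closed polygonal path (possibly with self-intersections) is given by a cyclic sequence of vertices $p_1,\dots,p_n$, $n\ge 2$, whose sides are the segments $p_ip_{i+1}$ (indices mod $n$); consecutive vertices are distinct, and the vertices are genuine, i.e. consecutive sides at a vertex do not form an angle equal to $\pi$. For $n=2$ the path is a doubly covered line segment. The length of the path is the sum of the lengths of its $n$ sides. The inner angle bisector at $p_i$ is the halfline starting at $p_i$ that bisects the angle formed by the two sides $p_ip_{i-1}$ and $p_ip_{i+1}$ (if the two sides point in the same direction, it is that common direction). A closed polygonal path $P$ is a generalized billiard trajectory of $C$ if all vertices of $P$ lie on the boundary of $C$ and each of the inner angle bisectors of $P$ between two consecutive sides of $P$ is perpendicular to a supporting hyperplane of $C$ passing through the corresponding vertex of $P$. If $P$ has $n$ sides it is called $n$-periodic (of period $n$). *)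

theory Defs
  imports "HOL-Analysis.Analysis"
begin

definition convex_body :: "'a::euclidean_space set \<Rightarrow> bool" where
  "convex_body C \<longleftrightarrow> compact C \<and> convex C \<and> interior C \<noteq> {}"

definition vec_angle :: "'a::euclidean_space \<Rightarrow> 'a \<Rightarrow> real" where
  "vec_angle u v = arccos ((u \<bullet> v) / (norm u * norm v))"

definition halfline :: "'a::euclidean_space \<Rightarrow> 'a \<Rightarrow> 'a set" where
  "halfline p w = {p + t *\<^sub>R w | t. 0 \<le> t}"

text \<open>A direction making half of the angle between two vectors with each of them automatically lies
  in the plane of these vectors; see \<open>inner_angle_bisector_iff\<close> below. The definition is meant for
  \<open>q \<noteq> p\<close>, \<open>r \<noteq> p\<close> and an angle different from \<open>pi\<close>.\<close>

definition inner_angle_bisector :: "'a::euclidean_space \<Rightarrow> 'a \<Rightarrow> 'a \<Rightarrow> 'a set \<Rightarrow> bool" where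
  "inner_angle_bisector q p r L \<longleftrightarrow>
     (\<exists>w. w \<noteq> 0 \<and> L = halfline p w \<and>
          vec_angle (q - p) w = vec_angle (q - p) (r - p) / 2 \<and>
          vec_angle (r - p) w = vec_angle (q - p) (r - p) / 2)"

definition supporting_hyperplane :: "'a::euclidean_space set \<Rightarrow> 'a set \<Rightarrow> bool" where
  "supporting_hyperplane C H \<longleftrightarrow>
     (\<exists>a b. a \<noteq> 0 \<and> H = {x. a \<bullet> x = b} \<and> C \<subseteq> {x. a \<bullet> x \<le> b} \<and> C \<inter> H \<noteq> {})"

definition perpendicular :: "'a::euclidean_space set \<Rightarrow> 'a set \<Rightarrow> bool" where
  "perpendicular L H \<longleftrightarrow> (\<forall>x\<in>L. \<forall>y\<in>L. \<forall>h\<in>H. \<forall>k\<in>H. orthogonal (x - y) (h - k))"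

text \<open>A closed polygonal path is represented by the list of its vertices. It is cyclic: indices are
  taken modulo the length of the list.\<close>

definition next_vertex :: "'a list \<Rightarrow> nat \<Rightarrow> 'a" where
  "next_vertex ps i = ps ! (Suc i mod length ps)"

definition prev_vertex :: "'a list \<Rightarrow> nat \<Rightarrow> 'a" where
  "prev_vertex ps i = ps ! ((i + length ps - 1) mod length ps)"

definition closed_polygonal_path :: "'a::euclidean_space list \<Rightarrow> bool" where
  "closed_polygonal_path ps \<longleftrightarrow>
     length ps \<ge> 2 \<and>
     (\<forall>i<length ps. ps ! i \<noteq> next_vertex ps i \<and>
        vec_angle (prev_vertex ps i - ps ! i) (next_vertex ps i - ps ! i) \<noteq> pi)"

definition path_len :: "'a::euclidean_space list \<Rightarrow> real" where
  "path_len ps = (\<Sum>i<length ps. dist (ps ! i) (next_vertex ps i))"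

definition generalized_billiard_trajectory ::
    "'a::euclidean_space set \<Rightarrow> 'a list \<Rightarrow> bool" where
  "generalized_billiard_trajectory C ps \<longleftrightarrow>
     closed_polygonal_path ps \<and>
     (\<forall>i<length ps. ps ! i \<in> frontier C \<and>
        (\<exists>L H. inner_angle_bisector (prev_vertex ps i) (ps ! i) (next_vertex ps i) L \<and>
               supporting_hyperplane C H \<and> ps ! i \<in> H \<and> perpendicular L H))"

text \<open>The number of sides equals the number of vertices.\<close>

definition period :: "'a list \<Rightarrow> nat" where
  "period ps = length ps"

definition shortest_generalized_billiard_trajectory ::
    "'a::euclidean_space set \<Rightarrow> 'a list \<Rightarrow> bool" where
  "shortest_generalized_billiard_trajectory C ps \<longleftrightarrow>
     generalized_billiard_trajectory C ps \<and>
     (\<forall>qs. generalized_billiard_trajectory C qs \<longrightarrow> path_len ps \<le> path_len qs)"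

lemma cos_vec_angle: "cos (vec_angle u v) = (u \<bullet> v) / (norm u * norm v)"
proof -
  have "\<bar>(u \<bullet> v) / (norm u * norm v)\<bar> \<le> 1"
    using Cauchy_Schwarz_ineq2[of u v] by (cases "u = 0 \<or> v = 0") (auto simp: divide_simps)
  then show ?thesis unfolding vec_angle_def by (simp add: cos_arccos_abs)
qed

lemma vec_angle_bounds: "0 \<le> vec_angle u v" "vec_angle u v \<le> pi"
proof -
  have "\<bar>(u \<bullet> v) / (norm u * norm v)\<bar> \<le> 1"
    using Cauchy_Schwarz_ineq2[of u v] by (cases "u = 0 \<or> v = 0") (auto simp: divide_simps)
  then show "0 \<le> vec_angle u v" "vec_angle u v \<le> pi"
    unfolding vec_angle_def abs_le_iff by (intro arccos_lbound arccos_ubound; linarith)+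
qed

lemma halfline_scale:
  assumes "c > 0" shows "halfline p (c *\<^sub>R w) = halfline p w"
proof (intro set_eqI iffI)
  fix x assume "x \<in> halfline p (c *\<^sub>R w)"
  then obtain t where "t \<ge> 0" "x = p + t *\<^sub>R c *\<^sub>R w" by (auto simp: halfline_def)
  then show "x \<in> halfline p w" using assms
    by (auto simp: halfline_def intro!: exI[of _ "t * c"])
next
  fix x assume "x \<in> halfline p w"
  then obtain t where "t \<ge> 0" "x = p + t *\<^sub>R w" by (auto simp: halfline_def)
  then show "x \<in> halfline p (c *\<^sub>R w)" using assms
    by (auto simp: halfline_def intro!: exI[of _ "t / c"])
qed

lemma vec_angle_eq_iff:
  "vec_angle u v = t \<longleftrightarrow> 0 \<le> t \<and> t \<le> pi \<and> cos t = sgn u \<bullet> sgn v"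
proof -
  have c: "cos (vec_angle u v) = sgn u \<bullet> sgn v"
    by (simp add: cos_vec_angle sgn_div_norm divide_inverse mult_ac)
  show ?thesis
    using c vec_angle_bounds[of u v] cos_inj_pi[of "vec_angle u v" t] by auto
qed

lemma inner_angle_bisector_iff:
  assumes "q \<noteq> p" "r \<noteq> p" "vec_angle (q - p) (r - p) \<noteq> pi"
  shows "inner_angle_bisector q p r L \<longleftrightarrow> L = halfline p (sgn (q - p) + sgn (r - p))"
proof -
  define u v where "u = sgn (q - p)" and "v = sgn (r - p)"
  define h where "h = vec_angle (q - p) (r - p) / 2"
  define c where "c = cos h"
  have h: "0 \<le> h" "h < pi / 2"
    using vec_angle_bounds[of "q - p" "r - p"] assms(3) by (auto simp: h_def)
  then have c0: "c > 0" unfolding c_def by (intro cos_gt_zero_pi) auto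
  have uu: "u \<bullet> u = 1" "v \<bullet> v = 1"
    using assms by (auto simp: u_def v_def norm_sgn simp flip: power2_norm_eq_inner)
  have "cos (2 * h) = u \<bullet> v"
    using vec_angle_eq_iff[of "q - p" "r - p" "2 * h"] by (simp add: h_def u_def v_def)
  then have uv: "u \<bullet> v = 2 * c\<^sup>2 - 1" by (simp add: cos_double_cos c_def)
  have *: "vec_angle (q - p) w = h \<longleftrightarrow> u \<bullet> sgn w = c" "vec_angle (r - p) w = h \<longleftrightarrow> v \<bullet> sgn w = c" for w
    using h by (auto simp: vec_angle_eq_iff u_def v_def c_def)
  have nuv: "(u + v) \<bullet> (u + v) = (2 * c)\<^sup>2"
    using uu uv by (simp add: inner_add_left inner_add_right inner_commute power_mult_distrib)
  then have norm: "norm (u + v) = 2 * c"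
    using c0 by (metis norm_eq_sqrt_inner real_sqrt_unique less_imp_le mult_pos_pos zero_less_numeral)
  have eq: "L = halfline p (u + v)"
    if w: "w \<noteq> 0" "L = halfline p w" "u \<bullet> sgn w = c" "v \<bullet> sgn w = c" for w
  proof -
    have "sgn w \<bullet> sgn w = 1" using w by (simp add: norm_sgn flip: power2_norm_eq_inner)
    then have "(u + v - (2 * c) *\<^sub>R sgn w) \<bullet> (u + v - (2 * c) *\<^sub>R sgn w) = 0"
      using w uu uv
      by (simp add: inner_add_left inner_add_right inner_diff_left inner_diff_right
          inner_commute power2_eq_square algebra_simps)
    then have "u + v = (2 * c / norm w) *\<^sub>R w"
      by (simp add: sgn_div_norm divide_inverse)
    then show ?thesis using halfline_scale[of "2 * c / norm w" p w] c0 w by simp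
  qed
  have "u + v \<noteq> 0" using norm c0 by auto
  moreover have "u \<bullet> sgn (u + v) = c" "v \<bullet> sgn (u + v) = c"
    using c0 uu uv by (auto simp: sgn_div_norm norm inner_add_right inner_commute
        power2_eq_square field_simps)
  ultimately show ?thesis
    unfolding inner_angle_bisector_def h_def[symmetric] * u_def[symmetric] v_def[symmetric]
    using eq by blast
qed

end

theory Submission
  imports Defs
begin

text \<open>The proof passes from billiard trajectories to a class of closed paths that is easier to minimise
  over. Call a set of points a misfit if none of its translates lies in the interior of \<open>C\<close>. The
  shortest billiard trajectories turn out to have the length of the shortest closed paths whose
  vertex set is a misfit, and both assertions follow from this.

  Every billiard trajectory is a misfit (\<open>billiard_trajectory_not_fits\<close>). At each vertex the sum of
  the unit vectors along the two sides is a negative multiple of an outer normal of \<open>C\<close>, so moving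
  the vertex into the interior by a vector \<open>y\<close> forces that sum to have a positive inner product with
  \<open>y\<close>. But along the whole closed path these vectors cancel, because each side contributes its
  direction once with either sign.

  Being a misfit depends on at most \<open>DIM('a) + 1\<close> of the vertices: \<open>p + y\<close> lies in the interior for
  all vertices \<open>p\<close> if and only if \<open>y\<close> lies in all translates \<open>interior C - p\<close>, and Helly's theorem
  applies to these. Dropping a superfluous vertex does not lengthen the path, and shortens it if the
  vertex is genuine. Hence a misfit path with more than \<open>DIM('a) + 1\<close> genuine vertices is not a
  shortest one, which gives the bound on the period. It also reduces the search for a shortest
  misfit path to a fixed number of vertices, where compactness yields one
  (\<open>exists_shortest_not_fitting\<close>).

  It remains to see that a shortest misfit path, chosen with as few vertices as possible, has a
  translate that is a billiard trajectory. Shrinking the path makes it shorter, hence fitting, so in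
  the limit a translate lies in \<open>C\<close> itself (\<open>minimal_misfit_fits_closed\<close>). For a vertex \<open>p\<close> of
  this translate the other vertices fit. The positions of \<open>p\<close> for which all vertices together fit
  form an open convex set that does not contain \<open>p\<close>; a hyperplane through \<open>p\<close> that avoids it turns
  out to support \<open>C\<close> (\<open>supporting_hyperplane_at_critical_point\<close>). As long as \<open>p\<close> moves within this
  hyperplane the path stays a misfit, so \<open>p\<close> minimises the sum of the distances to its two
  neighbours there, and by the reflection law the bisector at \<open>p\<close> is perpendicular to the
  hyperplane.\<close>

section \<open>Lengths of closed paths\<close>

text \<open>The length of the path without its closing side: the part of \<open>path_len\<close> that does not change
  when a vertex is prepended.\<close>

definition open_len :: "'a::euclidean_space list \<Rightarrow> real" where
  "open_len qs = (\<Sum>i<length qs - 1. dist (qs ! i) (qs ! Suc i))"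

lemma path_len_eq_open_len:
  assumes "qs \<noteq> []"
  shows "path_len qs = open_len qs + dist (last qs) (hd qs)"
proof -
  obtain n where n: "length qs = Suc n" using assms by (cases qs) auto
  have "(\<Sum>i<n. dist (qs ! i) (next_vertex qs i)) = (\<Sum>i<n. dist (qs ! i) (qs ! Suc i))"
    by (rule sum.cong) (auto simp: next_vertex_def n)
  then show ?thesis using assms
    by (simp add: path_len_def open_len_def n last_conv_nth hd_conv_nth) (simp add: next_vertex_def n)
qed

lemma open_len_Cons: "qs \<noteq> [] \<Longrightarrow> open_len (p # qs) = dist p (hd qs) + open_len qs"
  by (cases qs) (auto simp: open_len_def sum.lessThan_Suc_shift simp del: sum.lessThan_Suc)

lemma open_len_snoc: "qs \<noteq> [] \<Longrightarrow> open_len (qs @ [p]) = open_len qs + dist (last qs) p"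
  by (induction qs) (auto simp: open_len_Cons, simp_all add: open_len_def)

lemma path_len_Cons:
  "qs \<noteq> [] \<Longrightarrow> path_len (p # qs) = dist p (hd qs) + open_len qs + dist (last qs) p"
  by (simp add: path_len_eq_open_len open_len_Cons)

text \<open>Since the starting point of the cyclic list is immaterial, any vertex may be studied as the first
  one.\<close>

lemma path_len_rotate: "path_len (rotate k ps) = path_len ps"
proof (induction k)
  case (Suc k)
  have "path_len (rotate1 xs) = path_len xs" for xs :: "'a list"
  proof (cases xs)
    case (Cons p qs)
    then show ?thesis
      by (cases "qs = []") (auto simp: path_len_eq_open_len open_len_Cons open_len_snoc)
  qed simp
  then show ?case using Suc by simp
qed simp

text \<open>Once vertex \<open>i\<close> is first, its two neighbours are the ends of the remaining list.\<close>

lemma rotate_to_vertex: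
  assumes "i < length ps" "length ps \<ge> 2"
  obtains qs where "rotate i ps = ps ! i # qs" "qs \<noteq> []" "hd qs = next_vertex ps i"
    "last qs = prev_vertex ps i" "Suc (length qs) = length ps" "set ps = insert (ps ! i) (set qs)"
proof -
  define qs where "qs = tl (rotate i ps)"
  have ne: "rotate i ps \<noteq> []" using assms by auto
  have len: "length qs = length ps - 1" by (simp add: qs_def)
  have "hd (rotate i ps) = ps ! i" using assms ne by (simp add: hd_conv_nth nth_rotate)
  then have r: "rotate i ps = ps ! i # qs" using ne by (metis qs_def list.collapse)
  have q: "qs \<noteq> []" using len assms by auto
  have nth: "qs ! j = ps ! ((i + Suc j) mod length ps)" if "j < length qs" for j
    using that len nth_rotate[of "Suc j" ps i] by (simp add: r)
  have "hd qs = next_vertex ps i"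
    using nth[of 0] q by (simp add: hd_conv_nth next_vertex_def)
  moreover have "last qs = prev_vertex ps i"
    using nth[of "length qs - 1"] q len assms
    by (simp add: last_conv_nth prev_vertex_def Suc_diff_Suc numeral_2_eq_2)
  moreover have "set ps = insert (ps ! i) (set qs)"
    using r by (metis list.simps(15) set_rotate)
  ultimately show ?thesis using that r q len assms by auto
qed

lemma path_len_drop_le: "path_len qs \<le> path_len (p # qs)"
proof (cases "qs = []")
  case True then show ?thesis by (simp add: path_len_def next_vertex_def)
next
  case False
  then show ?thesis using dist_triangle[of "last qs" "hd qs" p]
    by (simp add: path_len_Cons path_len_eq_open_len[of qs])
qed

text \<open>The angle is \<open>pi\<close> exactly in the case of equality in the Cauchy-Schwarz inequality for \<open>q - p\<close>
  and \<open>p - r\<close>, which is also the case of equality in the triangle inequality.\<close>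

lemma vec_angle_pi_iff_between:
  assumes "q \<noteq> p" "r \<noteq> p"
  shows "vec_angle (q - p) (r - p) = pi \<longleftrightarrow> between (q, r) p"
proof -
  define u v where "u = q - p" and "v = r - p"
  have nz: "norm u > 0" "norm v > 0" using assms by (auto simp: u_def v_def)
  have "vec_angle u v = pi \<longleftrightarrow> u \<bullet> (- v) = norm u * norm (- v)"
    using nz by (auto simp: vec_angle_eq_iff sgn_div_norm field_simps)
  also have "\<dots> \<longleftrightarrow> norm (u + - v) = norm u + norm (- v)"
    unfolding norm_cauchy_schwarz_eq norm_triangle_eq ..
  also have "\<dots> \<longleftrightarrow> between (q, r) p"
    unfolding between by (simp add: u_def v_def dist_norm norm_minus_commute)
  finally show ?thesis by (simp add: u_def v_def)
qed

lemma path_len_drop_less: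
  assumes "qs \<noteq> []" "\<not> between (last qs, hd qs) p"
  shows "path_len qs < path_len (p # qs)"
  using assms dist_triangle[of "last qs" "hd qs" p]
  by (auto simp: path_len_Cons path_len_eq_open_len[of qs] between)

text \<open>The form in which genuineness of the vertices is used: the triangle inequality is strict there.\<close>

lemma neighbours_of_genuine_vertex:
  assumes "closed_polygonal_path ps" "i < length ps"
  shows "next_vertex ps i \<noteq> ps ! i" "prev_vertex ps i \<noteq> ps ! i"
    and "\<not> between (prev_vertex ps i, next_vertex ps i) (ps ! i)"
proof -
  have len: "length ps \<ge> 2"
    and dist: "\<And>j. j < length ps \<Longrightarrow> ps ! j \<noteq> next_vertex ps j"
    and angle: "vec_angle (prev_vertex ps i - ps ! i) (next_vertex ps i - ps ! i) \<noteq> pi"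
    using assms unfolding closed_polygonal_path_def by auto
  show r: "next_vertex ps i \<noteq> ps ! i" using dist[OF assms(2)] by simp
  define j where "j = (i + length ps - 1) mod length ps"
  have j: "j < length ps" unfolding j_def using len by (intro mod_less_divisor) auto
  have "Suc (i + length ps - 1) = i + length ps" using len by simp
  then have "Suc j mod length ps = i"
    using assms(2) mod_Suc_eq[of "i + length ps - 1" "length ps"] by (simp add: j_def)
  then show q: "prev_vertex ps i \<noteq> ps ! i"
    using dist[OF j] by (simp add: prev_vertex_def next_vertex_def j_def)
  show "\<not> between (prev_vertex ps i, next_vertex ps i) (ps ! i)"
    using vec_angle_pi_iff_between[OF q r] angle by simp
qed

lemma neighbours_in_set:
  assumes "ps \<noteq> []"
  shows "next_vertex ps i \<in> set ps" "prev_vertex ps i \<in> set ps"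
  unfolding next_vertex_def prev_vertex_def using assms by (auto intro!: nth_mem mod_less_divisor)

lemma next_vertex_map: "ps \<noteq> [] \<Longrightarrow> next_vertex (map f ps) i = f (next_vertex ps i)"
  by (simp add: next_vertex_def)

lemma path_len_map_add: "path_len (map (\<lambda>p. p + y) ps) = path_len ps"
proof (cases "ps = []")
  case False
  then show ?thesis unfolding path_len_def by (simp add: next_vertex_map dist_norm)
qed (simp add: path_len_def)

lemma path_len_map_scale:
  assumes "t \<ge> 0"
  shows "path_len (map (\<lambda>p. t *\<^sub>R p) ps) = t * path_len ps"
proof -
  have "path_len (map (\<lambda>p. t *\<^sub>R p) ps)
      = (\<Sum>i<length ps. t * dist (ps ! i) (next_vertex ps i))"
    unfolding path_len_def length_map
  proof (rule sum.cong)
    fix i assume i: "i \<in> {..<length ps}"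
    then have "ps \<noteq> []" by auto
    then show "dist (map (\<lambda>p. t *\<^sub>R p) ps ! i) (next_vertex (map (\<lambda>p. t *\<^sub>R p) ps) i)
        = t * dist (ps ! i) (next_vertex ps i)"
      using i assms by (simp add: next_vertex_map dist_norm flip: scaleR_diff_right)
  qed simp
  then show ?thesis by (simp add: path_len_def sum_distrib_left)
qed

lemma dist_hd_le_path_len:
  assumes "p \<in> set ps"
  shows "dist (hd ps) p \<le> path_len ps"
proof -
  obtain i where i: "i < length ps" "p = ps ! i" using assms by (metis in_set_conv_nth)
  have "dist (hd ps) (ps ! j) \<le> (\<Sum>k<j. dist (ps ! k) (next_vertex ps k))" if "j < length ps" for j
    using that
  proof (induction j)
    case 0 then show ?case by (cases ps) auto
  next
    case (Suc j)
    then have "next_vertex ps j = ps ! Suc j" by (simp add: next_vertex_def)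
    then show ?case using Suc dist_triangle[of "hd ps" "ps ! Suc j" "ps ! j"] by simp
  qed
  also have "(\<Sum>k<i. dist (ps ! k) (next_vertex ps k)) \<le> path_len ps"
    unfolding path_len_def using i by (intro sum_mono2) auto
  finally show ?thesis using i by simp
qed

section \<open>Sets that can be translated into the interior\<close>

definition fits_inside :: "'a::euclidean_space set \<Rightarrow> 'a set \<Rightarrow> bool" where
  "fits_inside C S \<longleftrightarrow> (\<exists>y. \<forall>p\<in>S. p + y \<in> interior C)"

lemma fits_inside_subset: "fits_inside C T \<Longrightarrow> S \<subseteq> T \<Longrightarrow> fits_inside C S"
  unfolding fits_inside_def by blast

lemma fits_inside_translate: "fits_inside C ((\<lambda>p. p + y) ` S) \<longleftrightarrow> fits_inside C S"
proof
  assume "fits_inside C ((\<lambda>p. p + y) ` S)"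
  then show "fits_inside C S"
    unfolding fits_inside_def by (auto simp: add.assoc)
next
  assume "fits_inside C S"
  then obtain z where "\<forall>p\<in>S. p + z \<in> interior C" unfolding fits_inside_def by blast
  then show "fits_inside C ((\<lambda>p. p + y) ` S)"
    unfolding fits_inside_def by (intro exI[of _ "z - y"]) auto
qed

text \<open>A vertex on the segment between two others can be dropped from a misfit: by convexity it follows
  its two neighbours into the interior.\<close>

lemma fits_inside_insert_between:
  assumes "convex C" "between (q, r) p" "q \<in> S" "r \<in> S" "fits_inside C S"
  shows "fits_inside C (insert p S)"
proof -
  obtain y where y: "\<forall>x\<in>S. x + y \<in> interior C" using assms by (auto simp: fits_inside_def)
  obtain u where u: "0 \<le> u" "u \<le> 1" "p = (1 - u) *\<^sub>R q + u *\<^sub>R r"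
    using assms(2) unfolding between_mem_segment by (auto simp: in_segment)
  have "(1 - u) *\<^sub>R (q + y) + u *\<^sub>R (r + y) \<in> interior C"
    using y assms u convex_interior[OF assms(1)] by (intro convexD) auto
  also have "(1 - u) *\<^sub>R (q + y) + u *\<^sub>R (r + y) = p + y"
    using u by (simp add: algebra_simps)
  finally show ?thesis using y unfolding fits_inside_def by blast
qed

text \<open>Helly's theorem for the sets \<open>interior C - p\<close>: a common point of them is a vector that translates
  all the points \<open>p\<close> into the interior.\<close>

lemma small_subset_not_fits:
  fixes C S :: "'a::euclidean_space set"
  assumes "convex C" "finite S" "\<not> fits_inside C S"
  obtains T where "T \<subseteq> S" "card T \<le> DIM('a) + 1" "\<not> fits_inside C T"
proof (cases "card S \<le> DIM('a) + 1")
  case True then show ?thesis using that assms by blast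
next
  case False
  define K where "K p = (\<lambda>x. x - p) ` interior C" for p
  have K: "y \<in> K p \<longleftrightarrow> p + y \<in> interior C" for y p
    unfolding K_def by (force simp: algebra_simps image_iff)
  have fits: "fits_inside C T \<longleftrightarrow> \<Inter> (K ` T) \<noteq> {}" for T
    unfolding fits_inside_def ex_in_conv[symmetric] by (simp add: K)
  have conv: "\<forall>k\<in>K ` S. convex k"
    using convex_interior[OF assms(1)] by (auto simp: K_def intro!: convex_translation_subtract)
  have "\<exists>F\<subseteq>K ` S. card F \<le> DIM('a) + 1 \<and> finite F \<and> \<Inter> F = {}"
  proof (cases "card (K ` S) \<ge> DIM('a) + 1")
    case True
    then obtain F where "F \<subseteq> K ` S" "card F = DIM('a) + 1" "\<Inter> F = {}"
      using Helly[of "K ` S"] conv assms(3) fits by metis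
    then show ?thesis using assms(2) by (metis finite_imageI finite_subset order_refl)
  next
    case False
    then show ?thesis using assms(2,3) fits by (intro exI[of _ "K ` S"]) auto
  qed
  then obtain F where F: "F \<subseteq> K ` S" "card F \<le> DIM('a) + 1" "finite F" "\<Inter> F = {}" by blast
  obtain T where "T \<subseteq> S" "inj_on K T" "F = K ` T" using F(1) by (metis subset_image_inj)
  then show ?thesis using that F fits by (metis card_image)
qed

text \<open>The vertices may repeat, so a position in the list is needed that misses one chosen occurrence
  of each point of the small misfit.\<close>

lemma redundant_vertex:
  fixes C :: "'a::euclidean_space set"
  assumes "convex C" "\<not> fits_inside C (set ps)" "length ps > DIM('a) + 1"
  obtains i where "i < length ps" "\<not> fits_inside C (set (tl (rotate i ps)))"
proof -
  obtain T where T: "T \<subseteq> set ps" "card T \<le> DIM('a) + 1" "\<not> fits_inside C T"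
    using small_subset_not_fits[OF assms(1) _ assms(2)] by blast
  define f where "f p = (SOME i. i < length ps \<and> ps ! i = p)" for p
  have f: "f p < length ps" "ps ! f p = p" if "p \<in> T" for p
    using T(1) that someI_ex[of "\<lambda>i. i < length ps \<and> ps ! i = p"]
    unfolding f_def by (auto simp: in_set_conv_nth subset_iff)
  have finT: "finite T" using T(1) finite_subset by blast
  have "card (f ` T) < card {..<length ps}"
    using card_image_le[OF finT, of f] T(2) assms(3) by simp
  then have "\<not> {..<length ps} \<subseteq> f ` T"
    using card_mono[of "f ` T" "{..<length ps}"] finT by auto
  then obtain i where i: "i < length ps" "i \<notin> f ` T" by auto
  have "T \<subseteq> set (tl (rotate i ps))"
  proof
    fix p assume p: "p \<in> T"
    let ?n = "length ps"
    \<comment> \<open>The index at which the chosen occurrence of \<open>p\<close> appears after the rotation; it is not \<open>0\<close>.\<close>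
    define k where "k = (f p + ?n - i) mod ?n"
    have fi: "f p < ?n" "f p \<noteq> i" using f[OF p] i(2) p by auto
    have k: "k < ?n" "(i + k) mod ?n = f p" "k \<noteq> 0"
    proof -
      show "k < ?n" unfolding k_def using i by (intro mod_less_divisor) auto
      show "(i + k) mod ?n = f p" using i fi by (simp add: k_def mod_add_right_eq)
      then show "k \<noteq> 0" using i fi by (metis add_0_right mod_less)
    qed
    then have "rotate i ps ! k = p" using f[OF p] by (simp add: nth_rotate)
    then have "tl (rotate i ps) ! (k - 1) = p" "k - 1 < length (tl (rotate i ps))"
      using k by (simp_all add: nth_tl)
    then show "p \<in> set (tl (rotate i ps))" by (metis nth_mem)
  qed
  then show ?thesis using that i(1) T(3) fits_inside_subset by blast
qed

section \<open>Billiard trajectories do not fit inside\<close>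

text \<open>A vector orthogonal to the hyperplane \<open>{z. a \<bullet> z = 0}\<close> equals its own projection onto \<open>a\<close>.\<close>

lemma parallel_if_orthogonal_complement:
  fixes a w :: "'a::euclidean_space"
  assumes "a \<noteq> 0" "\<And>z. a \<bullet> z = 0 \<Longrightarrow> w \<bullet> z = 0"
  shows "w = ((a \<bullet> w) / (a \<bullet> a)) *\<^sub>R a"
proof -
  define z where "z = w - ((a \<bullet> w) / (a \<bullet> a)) *\<^sub>R a"
  have az: "a \<bullet> z = 0" using assms(1) by (simp add: z_def inner_diff_right)
  moreover have "w \<bullet> z = 0" using assms(2) az .
  ultimately have "z \<bullet> z = 0" by (subst (1) z_def) (simp add: inner_diff_left)
  then show ?thesis by (simp add: z_def)
qed

text \<open>The direction of each side occurs with opposite signs at its two endpoints.\<close>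

lemma sum_unit_sides_eq_0:
  fixes ps :: "'a::euclidean_space list"
  assumes "length ps \<ge> 2"
  shows "(\<Sum>i<length ps. sgn (prev_vertex ps i - ps ! i) + sgn (next_vertex ps i - ps ! i)) = 0"
proof -
  let ?n = "length ps"
  have "bij_betw (\<lambda>i. Suc i mod ?n) {..<?n} {..<?n}"
  proof -
    have inj: "inj_on (\<lambda>i. Suc i mod ?n) {..<?n}"
      by (rule inj_onI) (auto simp: mod_Suc split: if_splits)
    moreover have "(\<lambda>i. Suc i mod ?n) ` {..<?n} \<subseteq> {..<?n}"
      using assms by (auto intro!: mod_less_divisor)
    ultimately show ?thesis
      by (simp add: bij_betw_def endo_inj_surj)
  qed
  then have "(\<Sum>i<?n. sgn (prev_vertex ps i - ps ! i))
      = (\<Sum>j<?n. sgn (prev_vertex ps (Suc j mod ?n) - ps ! (Suc j mod ?n)))"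
    by (rule sum.reindex_bij_betw[symmetric])
  also have "\<dots> = (\<Sum>j<?n. - sgn (next_vertex ps j - ps ! j))"
  proof (rule sum.cong)
    fix j assume "j \<in> {..<?n}"
    then have j: "j < ?n" by simp
    have "(Suc j mod ?n + ?n - 1) mod ?n = j"
    proof (cases "Suc j = ?n")
      case True then show ?thesis using j by (metis add_0 diff_Suc_1 mod_less mod_self)
    next
      case False then show ?thesis using j by simp
    qed
    then have "prev_vertex ps (Suc j mod ?n) = ps ! j" by (simp add: prev_vertex_def)
    then show "sgn (prev_vertex ps (Suc j mod ?n) - ps ! (Suc j mod ?n)) = - sgn (next_vertex ps j - ps ! j)"
      by (simp add: next_vertex_def flip: sgn_minus)
  qed simp
  finally show ?thesis by (simp add: sum.distrib sum_negf)
qed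

text \<open>The bisector direction \<open>w\<close> is a multiple \<open>c *\<^sub>R a\<close> of the outer normal \<open>a\<close> of the supporting
  hyperplane. As both neighbours lie in \<open>C\<close>, on the inner side, \<open>c\<close> is negative; a translation
  taking the vertex into the interior moves it inwards as well, so that both factors of
  \<open>w \<bullet> y = c * (a \<bullet> y)\<close> are negative.\<close>

lemma billiard_trajectory_outer_normal:
  assumes "convex_body C" "generalized_billiard_trajectory C ps" "i < length ps"
    and "p + y \<in> interior C" "p = ps ! i"
  shows "(sgn (prev_vertex ps i - p) + sgn (next_vertex ps i - p)) \<bullet> y > 0"
proof -
  let ?q = "prev_vertex ps i" and ?r = "next_vertex ps i"
  define w where "w = sgn (?q - p) + sgn (?r - p)"
  have path: "closed_polygonal_path ps" and front: "set ps \<subseteq> frontier C"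
    using assms(2) unfolding generalized_billiard_trajectory_def by (auto simp: in_set_conv_nth)
  have q: "?q \<noteq> p" and r: "?r \<noteq> p"
    using neighbours_of_genuine_vertex[OF path assms(3)] assms(5) by auto
  have angle: "vec_angle (?q - p) (?r - p) \<noteq> pi"
    using path assms(3,5) unfolding closed_polygonal_path_def by blast
  have "frontier C \<subseteq> C"
    using assms(1) unfolding convex_body_def by (intro frontier_subset_closed compact_imp_closed) simp
  moreover have "ps \<noteq> []" using assms(3) by auto
  ultimately have qC: "?q \<in> C" and rC: "?r \<in> C"
    using front neighbours_in_set[of ps i] by auto
  obtain L H where L: "inner_angle_bisector ?q p ?r L" and H: "supporting_hyperplane C H"
    and pH: "p \<in> H" and perp: "perpendicular L H"
    using assms unfolding generalized_billiard_trajectory_def by metis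
  have Lw: "L = halfline p w"
    using L inner_angle_bisector_iff[OF q r angle] by (simp add: w_def)
  obtain a b where a: "a \<noteq> 0" "H = {x. a \<bullet> x = b}" "C \<subseteq> {x. a \<bullet> x \<le> b}"
    using H unfolding supporting_hyperplane_def by blast
  have ap: "a \<bullet> p = b" using pH a by simp
  have "w \<bullet> z = 0" if "a \<bullet> z = 0" for z
  proof -
    have "p + w \<in> L" "p \<in> L" "p + z \<in> H"
      unfolding Lw halfline_def using a ap that
      by (auto simp: inner_add_right intro: exI[of _ 1] exI[of _ 0])
    then have "orthogonal ((p + w) - p) ((p + z) - p)"
      using perp pH unfolding perpendicular_def by blast
    then show ?thesis by (simp add: orthogonal_def)
  qed
  then have wa: "w = ((a \<bullet> w) / (a \<bullet> a)) *\<^sub>R a"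
    by (rule parallel_if_orthogonal_complement[OF a(1)])
  have "w \<noteq> 0"
  proof
    assume "w = 0"
    then have "sgn (?r - p) = - sgn (?q - p)" by (simp add: w_def eq_neg_iff_add_eq_0 add.commute)
    then have "sgn (?q - p) \<bullet> sgn (?r - p) = - 1"
      using q by (simp add: norm_sgn flip: power2_norm_eq_inner)
    then show False using angle vec_angle_eq_iff[of "?q - p" "?r - p" pi] by simp
  qed
  have "a \<bullet> ?q \<le> a \<bullet> p" "a \<bullet> ?r \<le> a \<bullet> p" using qC rC a(3) ap by auto
  then have "a \<bullet> sgn (?q - p) \<le> 0" "a \<bullet> sgn (?r - p) \<le> 0"
    by (auto simp: sgn_div_norm inner_diff_right intro!: divide_nonpos_nonneg mult_nonneg_nonpos)
  then have aw: "a \<bullet> w \<le> 0" by (simp add: w_def inner_add_right)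
  moreover have "a \<bullet> w \<noteq> 0" using wa \<open>w \<noteq> 0\<close> by auto
  moreover have "p + y \<in> interior {x. a \<bullet> x \<le> b}"
    using assms(4) interior_mono[OF a(3)] by blast
  then have "a \<bullet> y < 0" using ap a(1) by (simp add: interior_halfspace_le inner_add_right)
  ultimately have "(a \<bullet> w) * (a \<bullet> y) > 0" by (simp add: mult_neg_neg)
  moreover have "w \<bullet> y = (a \<bullet> w) * (a \<bullet> y) / (a \<bullet> a)" by (subst wa) simp
  moreover have "a \<bullet> a > 0" using a(1) by simp
  ultimately show ?thesis unfolding w_def[symmetric] by (simp only: divide_pos_pos)
qed

lemma billiard_trajectory_not_fits:
  assumes "convex_body C" "generalized_billiard_trajectory C ps"
  shows "\<not> fits_inside C (set ps)"
proof
  assume "fits_inside C (set ps)"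
  then obtain y where y: "\<And>i. i < length ps \<Longrightarrow> ps ! i + y \<in> interior C"
    unfolding fits_inside_def by (metis nth_mem)
  let ?w = "\<lambda>i. sgn (prev_vertex ps i - ps ! i) + sgn (next_vertex ps i - ps ! i)"
  have len: "length ps \<ge> 2"
    using assms unfolding generalized_billiard_trajectory_def closed_polygonal_path_def by simp
  have "(\<Sum>i<length ps. ?w i \<bullet> y) > 0"
    using len billiard_trajectory_outer_normal[OF assms _ y refl]
    by (intro sum_pos) (auto simp: lessThan_empty_iff)
  then show False using sum_unit_sides_eq_0[OF len] by (simp flip: inner_sum_left)
qed

section \<open>Existence of a shortest path that does not fit\<close>

text \<open>Repeating the first vertex changes neither the length nor the vertex set. Lists with fewer vertices
  can thus be treated as lists of one common length.\<close>

lemma pad_vertices: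
  assumes "ps \<noteq> []" "length ps \<le> n"
  obtains qs where "length qs = n" "set qs = set ps" "path_len qs = path_len ps"
proof -
  have "\<exists>qs. length qs = n \<and> set qs = set ps \<and> path_len qs = path_len ps"
    using assms(2)
  proof (induction n rule: dec_induct)
    case base then show ?case by blast
  next
    case (step m)
    then obtain qs where qs: "length qs = m" "set qs = set ps" "path_len qs = path_len ps" by blast
    then have "qs \<noteq> []" using assms by auto
    then have "path_len (hd qs # qs) = path_len qs"
      by (simp add: path_len_Cons path_len_eq_open_len[of qs])
    moreover have "set (hd qs # qs) = set qs" using \<open>qs \<noteq> []\<close> by (cases qs) auto
    ultimately show ?case using qs by (intro exI[of _ "hd qs # qs"]) simp
  qed
  then show ?thesis using that by blast
qed

text \<open>Superfluous vertices are dropped as long as there are more than \<open>DIM('a) + 1\<close> of them.\<close>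

lemma few_vertices_suffice:
  fixes C :: "'a::euclidean_space set"
  assumes "convex C" "interior C \<noteq> {}" "\<not> fits_inside C (set ps)"
  obtains qs where "length qs = DIM('a) + 1" "\<not> fits_inside C (set qs)" "path_len qs \<le> path_len ps"
proof -
  have "\<exists>qs. length qs = DIM('a) + 1 \<and> \<not> fits_inside C (set qs) \<and> path_len qs \<le> path_len ps"
    using assms(3)
  proof (induction "length ps" arbitrary: ps rule: less_induct)
    case less
    show ?case
    proof (cases "length ps \<le> DIM('a) + 1")
      case True
      moreover have "ps \<noteq> []" using less(2) assms(2) by (auto simp: fits_inside_def)
      ultimately obtain qs where "length qs = DIM('a) + 1" "set qs = set ps" "path_len qs = path_len ps"
        using pad_vertices by blast
      then show ?thesis using less(2) by (intro exI[of _ qs]) simp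
    next
      case False
      then have "length ps > DIM('a) + 1" by simp
      then obtain i where i: "i < length ps" "\<not> fits_inside C (set (tl (rotate i ps)))"
        by (rule redundant_vertex[OF assms(1) less(2)])
      let ?qs = "tl (rotate i ps)"
      have "rotate i ps \<noteq> []" using i by auto
      then have "path_len ?qs \<le> path_len ps"
        using path_len_drop_le[of ?qs "hd (rotate i ps)"] by (simp add: path_len_rotate)
      moreover have "length ?qs < length ps" using i by simp
      note less(1)[OF this i(2)]
      then obtain qs where "length qs = DIM('a) + 1" "\<not> fits_inside C (set qs)"
          "path_len qs \<le> path_len ?qs"
        by blast
      ultimately show ?thesis by (intro exI[of _ qs]) simp
    qed
  qed
  then show ?thesis using that by blast
qed

text \<open>Two points farther apart than the diameter of \<open>C\<close>.\<close>

lemma exists_not_fits: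
  fixes C :: "'a::euclidean_space set"
  assumes "bounded C"
  obtains ps where "\<not> fits_inside C (set ps)"
proof -
  obtain e where e: "\<And>x y. x \<in> C \<Longrightarrow> y \<in> C \<Longrightarrow> dist x y \<le> e"
    using assms unfolding bounded_two_points by blast
  obtain v :: 'a where v: "norm v = \<bar>e\<bar> + 1"
    by (rule vector_choose_size[of "\<bar>e\<bar> + 1"]) auto
  have "\<not> fits_inside C (set [0, v])"
  proof
    assume "fits_inside C (set [0, v])"
    then obtain y where "y \<in> interior C" "v + y \<in> interior C"
      by (auto simp: fits_inside_def)
    then have "y \<in> C" "v + y \<in> C" using interior_subset by auto
    then show False using e[of "v + y" y] v by (simp add: dist_norm)
  qed
  then show ?thesis using that by blast
qed

lemma path_len_eq_sum_function:
  "path_len (map f [0..<n]) = (\<Sum>i<n. dist (f i) (f (Suc i mod n)))"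
  unfolding path_len_def length_map length_upt diff_zero
proof (rule sum.cong)
  fix i assume "i \<in> {..<n}"
  then have "i < n" "Suc i mod n < n" by auto
  then show "dist (map f [0..<n] ! i) (next_vertex (map f [0..<n]) i) = dist (f i) (f (Suc i mod n))"
    by (simp add: next_vertex_def)
qed simp

text \<open>Paths with \<open>n = DIM('a) + 1\<close> vertices are encoded as functions on \<open>nat\<close> that vanish from \<open>n\<close> on,
  so that in the product topology closed bounded sets of them are compact. Misfits form a closed
  set, since fitting with a given translation is an open condition; and they may be taken bounded,
  since a path of length at most \<open>R\<close> has a translate inside the ball of radius \<open>R\<close> around the origin.\<close>

lemma exists_shortest_not_fitting:
  fixes C :: "'a::euclidean_space set"
  assumes "convex_body C"
  obtains ps where "\<not> fits_inside C (set ps)"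
    "\<And>qs. \<not> fits_inside C (set qs) \<Longrightarrow> path_len ps \<le> path_len qs"
proof -
  have C: "convex C" "interior C \<noteq> {}" "bounded C"
    using assms compact_imp_bounded unfolding convex_body_def by auto
  define n where "n = DIM('a) + 1"
  obtain ps0 where ps0: "length ps0 = n" "\<not> fits_inside C (set ps0)"
  proof -
    obtain qs where "\<not> fits_inside C (set qs)" by (rule exists_not_fits[OF C(3)])
    then show thesis using few_vertices_suffice[OF C(1,2)] that unfolding n_def by blast
  qed
  define R where "R = path_len ps0"
  define B where "B = PiE UNIV (\<lambda>i. if i < n then cball (0::'a) R else {0})"
  define X where "X = {f. \<not> fits_inside C (f ` {..<n})}"
  have "compact B"
  proof -
    have "compactin (product_topology (\<lambda>i. euclidean) UNIV) B"
      unfolding B_def by (simp add: compactin_PiE)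
    then show ?thesis by (simp add: euclidean_product_topology)
  qed
  moreover have "closed X"
  proof -
    have "X = (\<Inter>y. \<Union>i<n. (\<lambda>f. f i + y) -` (- interior C))"
      unfolding X_def fits_inside_def by auto
    moreover have "closed ((\<lambda>f::nat \<Rightarrow> 'a. f i + y) -` (- interior C))" for i y
      by (intro closed_vimage continuous_intros continuous_on_product_coordinates) auto
    ultimately show ?thesis by auto
  qed
  ultimately have comp: "compact (B \<inter> X)" by (rule compact_Int_closed)
  \<comment> \<open>Any competitor can be translated so that its first vertex is the origin.\<close>
  have in_BX: "\<exists>f\<in>B \<inter> X. path_len (map f [0..<n]) = path_len qs"
    if "length qs = n" "\<not> fits_inside C (set qs)" "path_len qs \<le> R" for qs
  proof -
    define rs where "rs = map (\<lambda>p. p + - hd qs) qs"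
    define f where "f i = (if i < n then rs ! i else 0)" for i
    have len: "length rs = n" using that by (simp add: rs_def)
    then have map: "map f [0..<n] = rs" by (intro nth_equalityI) (auto simp: f_def)
    have "f ` {..<n} = set rs" unfolding map[symmetric] by auto
    also have "\<dots> = (\<lambda>p. p + - hd qs) ` set qs" by (simp add: rs_def)
    finally have "f \<in> X" using that(2) fits_inside_translate[of C "- hd qs" "set qs"]
      unfolding X_def by simp
    moreover have "norm (f i) \<le> R" if "i < n" for i
    proof -
      have "f i = qs ! i - hd qs" using that \<open>length qs = n\<close> by (simp add: f_def rs_def)
      then show ?thesis
        using dist_hd_le_path_len[of "qs ! i" qs] that \<open>length qs = n\<close> \<open>path_len qs \<le> R\<close>
        by (simp add: dist_norm norm_minus_commute)
    qed
    then have "f \<in> B" unfolding B_def by (auto simp: PiE_def f_def)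
    moreover have "path_len (map f [0..<n]) = path_len qs"
      unfolding map unfolding rs_def by (rule path_len_map_add)
    ultimately show ?thesis by blast
  qed
  have "B \<inter> X \<noteq> {}" using in_BX[OF ps0] by (auto simp: R_def)
  moreover have "continuous_on (B \<inter> X) (\<lambda>f. path_len (map f [0..<n]))"
    unfolding path_len_eq_sum_function
    by (intro continuous_intros continuous_on_subset[OF continuous_on_product_coordinates subset_UNIV])
  ultimately obtain f where f: "f \<in> B \<inter> X"
      "\<And>g. g \<in> B \<inter> X \<Longrightarrow> path_len (map f [0..<n]) \<le> path_len (map g [0..<n])"
    using continuous_attains_inf[OF comp] by metis
  have min: "path_len (map f [0..<n]) \<le> path_len qs"
    if qs: "length qs = n" "\<not> fits_inside C (set qs)" for qs
  proof (cases "path_len qs \<le> R")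
    case True
    then show ?thesis using in_BX[OF qs] f(2) by metis
  next
    case False
    then show ?thesis using in_BX[OF ps0] f(2) by (force simp: R_def)
  qed
  show ?thesis
  proof (rule that)
    show "\<not> fits_inside C (set (map f [0..<n]))"
      using f(1) by (simp add: X_def atLeast0LessThan)
    show "path_len (map f [0..<n]) \<le> path_len qs" if qs: "\<not> fits_inside C (set qs)" for qs
    proof -
      obtain qs' where "length qs' = n" "\<not> fits_inside C (set qs')" "path_len qs' \<le> path_len qs"
        unfolding n_def by (rule few_vertices_suffice[OF C(1,2) qs])
      then show ?thesis using min by fastforce
    qed
  qed
qed

section \<open>Shortest paths that do not fit are billiard trajectories\<close>

text \<open>The sum of the distances from a moving point to \<open>q\<close> and \<open>r\<close> has derivative
  \<open>- (sgn (q - p) + sgn (r - p)) \<bullet> z\<close> at \<open>p\<close> in direction \<open>z\<close>. At a minimum on a hyperplane it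
  vanishes for all directions within the hyperplane.\<close>

lemma reflection_law:
  fixes p q r :: "'a::euclidean_space"
  assumes "q \<noteq> p" "r \<noteq> p" "a \<bullet> z = 0"
    and min: "\<And>x. a \<bullet> x = a \<bullet> p \<Longrightarrow> dist q p + dist p r \<le> dist q x + dist x r"
  shows "(sgn (q - p) + sgn (r - p)) \<bullet> z = 0"
proof -
  define f where "f t = norm ((p - q) + t *\<^sub>R z) + norm ((p - r) + t *\<^sub>R z)" for t
  have D: "((\<lambda>t. norm (v + t *\<^sub>R z)) has_field_derivative sgn v \<bullet> z) (at 0)" if "v \<noteq> 0" for v
  proof -
    have "((\<lambda>t::real. v + t *\<^sub>R z) has_derivative (\<lambda>h. h *\<^sub>R z)) (at 0)"
      by (auto intro!: derivative_eq_intros)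
    moreover have "(norm has_derivative (\<lambda>h. h \<bullet> sgn v)) (at (v + 0 *\<^sub>R z))"
      using has_derivative_norm[OF that] by simp
    ultimately have "((\<lambda>t. norm (v + t *\<^sub>R z)) has_derivative (\<lambda>h. (h *\<^sub>R z) \<bullet> sgn v)) (at 0)"
      by (rule has_derivative_compose)
    then show ?thesis
      unfolding has_field_derivative_def
      by (rule has_derivative_eq_rhs) (auto simp: inner_commute mult.commute)
  qed
  have "(f has_field_derivative (sgn (p - q) \<bullet> z + sgn (p - r) \<bullet> z)) (at 0)"
    unfolding f_def using assms D by (intro DERIV_add) auto
  moreover have "f 0 \<le> f t" for t
    using min[of "p + t *\<^sub>R z"] assms(3)
    by (simp add: f_def dist_norm inner_add_right norm_minus_commute algebra_simps)
  ultimately have "sgn (p - q) \<bullet> z + sgn (p - r) \<bullet> z = 0"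
    by (intro DERIV_local_min[of f _ 0 1]) auto
  moreover have "sgn (q - p) = - sgn (p - q)" "sgn (r - p) = - sgn (p - r)"
    by (simp_all flip: sgn_minus)
  ultimately show ?thesis by (simp add: inner_diff_left)
qed

text \<open>Let \<open>K\<close> be the set of vectors that translate \<open>S\<close> into the interior of \<open>C\<close>. The points that fit
  together with \<open>S\<close> form the set \<open>U = interior C - K\<close>, which is open and convex, and \<open>p\<close> is separated
  from it by a hyperplane. Since \<open>S\<close> is contained in \<open>C\<close>, the set \<open>K\<close> contains arbitrarily short
  vectors, so \<open>interior C\<close> lies in the closure of \<open>U\<close>, and the hyperplane supports \<open>C\<close> at \<open>p\<close>.\<close>

lemma supporting_hyperplane_at_critical_point:
  fixes C :: "'a::euclidean_space set"
  assumes "convex_body C" "insert p S \<subseteq> C" "finite S"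
    and "fits_inside C S" "\<not> fits_inside C (insert p S)"
  obtains a where "a \<noteq> 0" "\<And>c. c \<in> C \<Longrightarrow> a \<bullet> c \<le> a \<bullet> p"
    "\<And>x. a \<bullet> x = a \<bullet> p \<Longrightarrow> \<not> fits_inside C (insert x S)"
proof -
  have C: "convex C" "closed C" "interior C \<noteq> {}" "convex (interior C)"
    using assms(1) compact_imp_closed convex_interior unfolding convex_body_def by auto
  define K where "K = {y. \<forall>q\<in>S. q + y \<in> interior C}"
  define U where "U = (\<Union>y\<in>K. (\<lambda>c. c - y) ` interior C)"
  have U: "x \<in> U \<longleftrightarrow> fits_inside C (insert x S)" for x
    unfolding U_def K_def fits_inside_def by (force simp: image_iff algebra_simps)
  have "open U" unfolding U_def by (auto intro!: open_translation_subtract)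
  have "convex K"
  proof (rule convexI)
    fix x y and u v :: real
    assume "x \<in> K" "y \<in> K" and uv: "0 \<le> u" "0 \<le> v" "u + v = 1"
    have "q + (u *\<^sub>R x + v *\<^sub>R y) \<in> interior C" if "q \<in> S" for q
    proof -
      have "u *\<^sub>R (q + x) + v *\<^sub>R (q + y) \<in> interior C"
        using \<open>x \<in> K\<close> \<open>y \<in> K\<close> that uv C(4) by (auto simp: K_def intro: convexD)
      also have "u *\<^sub>R (q + x) + v *\<^sub>R (q + y) = (u + v) *\<^sub>R q + (u *\<^sub>R x + v *\<^sub>R y)"
        by (simp add: algebra_simps)
      finally show ?thesis using uv by simp
    qed
    then show "u *\<^sub>R x + v *\<^sub>R y \<in> K" by (simp add: K_def)
  qed
  moreover have "U = (\<Union>c\<in>interior C. \<Union>y\<in>K. {c - y})" unfolding U_def by auto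
  ultimately have "convex U" using convex_differences[OF C(4)] by simp
  moreover have "U \<noteq> {}"
    using assms(4) C(3) unfolding U_def K_def fits_inside_def by auto
  moreover have "p \<notin> U" using U assms(5) by blast
  ultimately obtain a b where a: "a \<noteq> 0" "\<forall>x\<in>U. a \<bullet> x \<le> b" "b \<le> a \<bullet> p"
    using separating_hyperplane_sets[of U "{p}"] by auto
  have "U \<subseteq> {x. a \<bullet> x \<le> a \<bullet> p}" using a by force
  then have "U \<subseteq> interior {x. a \<bullet> x \<le> a \<bullet> p}"
    using \<open>open U\<close> interior_maximal by blast
  then have strict: "a \<bullet> x < a \<bullet> p" if "x \<in> U" for x
    using that a(1) by (auto simp: interior_halfspace_le)
  \<comment> \<open>The point \<open>c - e *\<^sub>R y\<close> lies in \<open>U\<close> for all small \<open>e > 0\<close> and tends to \<open>c\<close>.\<close>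
  have "a \<bullet> c \<le> a \<bullet> p" if c: "c \<in> interior C" for c
  proof -
    obtain y where y: "y \<in> K" using assms(4) by (auto simp: K_def fits_inside_def)
    have "a \<bullet> (c - e *\<^sub>R y) \<le> a \<bullet> p" if e: "0 < e" "e \<le> 1" for e
    proof -
      have "q + e *\<^sub>R y \<in> interior C" if "q \<in> S" for q
      proof -
        have "q - e *\<^sub>R (q - (q + y)) \<in> interior C"
          using that y assms(2) C closure_subset e unfolding K_def
          by (intro mem_interior_closure_convex_shrink) auto
        then show ?thesis by simp
      qed
      then have "e *\<^sub>R y \<in> K" by (simp add: K_def)
      then show ?thesis using c strict by (force simp: U_def)
    qed
    then have "\<forall>\<^sub>F e in at_right 0. a \<bullet> (c - e *\<^sub>R y) \<le> a \<bullet> p"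
      using eventually_at_right_real[of 0 1] by (auto elim!: eventually_mono)
    moreover have "((\<lambda>e. a \<bullet> (c - e *\<^sub>R y)) \<longlongrightarrow> a \<bullet> (c - 0 *\<^sub>R y)) (at_right 0)"
      by (intro tendsto_intros)
    ultimately show ?thesis
      using tendsto_upperbound[of _ _ "at_right (0::real)"] by (auto simp: trivial_limit_at_right_real)
  qed
  then have "interior C \<subseteq> {x. a \<bullet> x \<le> a \<bullet> p}" by auto
  then have "closure (interior C) \<subseteq> {x. a \<bullet> x \<le> a \<bullet> p}"
    by (rule closure_minimal) (rule closed_halfspace_le)
  moreover have "closure (interior C) = C"
    using C convex_closure_interior by (metis closure_closed)
  ultimately have "\<And>c. c \<in> C \<Longrightarrow> a \<bullet> c \<le> a \<bullet> p" by auto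
  moreover have "\<not> fits_inside C (insert x S)" if "a \<bullet> x = a \<bullet> p" for x
    using strict[of x] U that by auto
  ultimately show ?thesis using that a(1) by blast
qed

text \<open>Minimality is lexicographic: length first, then the number of vertices. The second criterion
  excludes degenerate vertices, since a repeated vertex or one on the segment between its neighbours
  could be dropped.\<close>

definition minimal_misfit :: "'a::euclidean_space set \<Rightarrow> 'a list \<Rightarrow> bool" where
  "minimal_misfit C ps \<longleftrightarrow> \<not> fits_inside C (set ps) \<and>
     (\<forall>qs. \<not> fits_inside C (set qs) \<longrightarrow>
        path_len ps < path_len qs \<or> path_len ps = path_len qs \<and> length ps \<le> length qs)"

lemma minimal_misfit_le:
  "minimal_misfit C ps \<Longrightarrow> \<not> fits_inside C (set qs) \<Longrightarrow> path_len ps \<le> path_len qs"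
  unfolding minimal_misfit_def by fastforce

lemma exists_minimal_misfit:
  assumes "convex_body C"
  obtains ps where "minimal_misfit C ps"
proof -
  obtain ps where ps: "\<not> fits_inside C (set ps)"
    "\<And>qs. \<not> fits_inside C (set qs) \<Longrightarrow> path_len ps \<le> path_len qs"
    by (rule exists_shortest_not_fitting[OF assms]) blast
  define P where "P qs \<longleftrightarrow> \<not> fits_inside C (set qs) \<and> path_len qs = path_len ps" for qs
  have "P ps" using ps(1) by (simp add: P_def)
  then obtain rs where rs: "P rs" "\<And>qs. P qs \<Longrightarrow> length rs \<le> length qs"
    using ex_has_least_nat[of P ps length] by blast
  have "path_len rs < path_len qs \<or> path_len rs = path_len qs \<and> length rs \<le> length qs"
    if "\<not> fits_inside C (set qs)" for qs
    using ps(2)[OF that] rs(2)[of qs] rs(1) that by (auto simp: P_def)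
  then show ?thesis using that rs(1) unfolding minimal_misfit_def P_def by blast
qed

lemma minimal_misfit_translate:
  assumes "minimal_misfit C ps"
  shows "minimal_misfit C (map (\<lambda>p. p + y) ps)"
  using assms fits_inside_translate[of C y "set ps"]
  unfolding minimal_misfit_def by (simp add: path_len_map_add)

text \<open>For \<open>t < 1\<close> the path scaled by \<open>t\<close> is shorter than a shortest misfit, hence fits. By compactness
  the translated copies converge, for some sequence of factors tending to \<open>1\<close>, to a translate of the
  path contained in \<open>C\<close>.\<close>

lemma minimal_misfit_fits_closed:
  fixes C :: "'a::euclidean_space set"
  assumes "convex_body C" "minimal_misfit C ps"
  obtains y where "\<And>p. p \<in> set ps \<Longrightarrow> p + y \<in> C"
proof -
  have C: "compact C" "closed C" "interior C \<noteq> {}"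
    using assms(1) compact_imp_closed unfolding convex_body_def by auto
  have unfit: "\<not> fits_inside C (set ps)" using assms(2) by (simp add: minimal_misfit_def)
  have ne: "ps \<noteq> []" using unfit C(3) by (auto simp: fits_inside_def)
  \<comment> \<open>A path of length zero consists of a single repeated point, which fits.\<close>
  have pos: "path_len ps > 0"
  proof (rule ccontr)
    assume "\<not> path_len ps > 0"
    then have "path_len ps \<le> 0" by simp
    then have eq: "p = hd ps" if "p \<in> set ps" for p
      using order_trans[OF dist_hd_le_path_len[OF that] \<open>path_len ps \<le> 0\<close>] by simp
    obtain c where "c \<in> interior C" using C(3) by blast
    then have "p + (c - hd ps) \<in> interior C" if "p \<in> set ps" for p
      using eq[OF that] by simp
    then show False using unfit unfolding fits_inside_def by blast
  qed
  define t where "t k = 1 - inverse (real (Suc k))" for k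
  have t: "0 \<le> t k" "t k < 1" for k
    unfolding t_def by (simp_all add: inverse_le_1_iff)
  have "\<exists>y. \<forall>p\<in>set ps. t k *\<^sub>R p + y \<in> C" for k
  proof -
    have "path_len (map (\<lambda>p. t k *\<^sub>R p) ps) < path_len ps"
      using path_len_map_scale[OF t(1), of k ps] t(2)[of k] pos by simp
    then have "fits_inside C (set (map (\<lambda>p. t k *\<^sub>R p) ps))"
      using minimal_misfit_le[OF assms(2)] by (meson not_le)
    then obtain y where "\<forall>p\<in>set ps. t k *\<^sub>R p + y \<in> interior C"
      unfolding fits_inside_def by auto
    then show ?thesis using interior_subset by (intro exI[of _ y]) blast
  qed
  then obtain y where y: "\<And>k p. p \<in> set ps \<Longrightarrow> t k *\<^sub>R p + y k \<in> C" by metis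
  define q where "q = hd ps"
  have q: "q \<in> set ps" using ne by (simp add: q_def)
  have "seq_compact C" using C(1) by (simp add: compact_eq_seq_compact_metric)
  moreover have "\<forall>k. t k *\<^sub>R q + y k \<in> C" using y q by blast
  ultimately obtain l r where "l \<in> C" and lr: "strict_mono (r :: nat \<Rightarrow> nat)"
      "((\<lambda>k. t k *\<^sub>R q + y k) \<circ> r) \<longlonglongrightarrow> l"
    by (rule seq_compactE)
  have "t \<longlonglongrightarrow> 1 - 0"
    unfolding t_def by (intro tendsto_diff tendsto_const LIMSEQ_inverse_real_of_nat)
  from LIMSEQ_subseq_LIMSEQ[OF this lr(1)] have tr: "(\<lambda>k. t (r k)) \<longlonglongrightarrow> 1"
    by (simp add: o_def)
  have "p + (l - q) \<in> C" if p: "p \<in> set ps" for p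
  proof -
    have lim: "(\<lambda>k. t (r k) *\<^sub>R (p - q) + (t (r k) *\<^sub>R q + y (r k))) \<longlonglongrightarrow> 1 *\<^sub>R (p - q) + l"
      using lr(2) by (intro tendsto_intros tr) (simp add: o_def)
    have mem: "t (r k) *\<^sub>R (p - q) + (t (r k) *\<^sub>R q + y (r k)) \<in> C" for k
      using y[OF p, of "r k"] by (simp add: algebra_simps)
    have "1 *\<^sub>R (p - q) + l \<in> C" by (rule closed_sequentially[OF C(2) mem lim])
    then show ?thesis by (simp add: algebra_simps)
  qed
  then show ?thesis by (rule that)
qed

text \<open>At every vertex the other vertices fit, by minimality of the number of vertices. This makes the
  vertex genuine and supplies the supporting hyperplane; minimality of the length supplies the
  reflection law.\<close>

lemma minimal_misfit_imp_billiard_trajectory: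
  fixes C :: "'a::euclidean_space set"
  assumes "convex_body C" "minimal_misfit C ps" "set ps \<subseteq> C"
  shows "generalized_billiard_trajectory C ps"
proof -
  have C: "convex C" "closed C" "interior C \<noteq> {}"
    using assms(1) compact_imp_closed unfolding convex_body_def by auto
  have unfit: "\<not> fits_inside C (set ps)" using assms(2) by (simp add: minimal_misfit_def)
  have len: "length ps \<ge> 2"
  proof (rule ccontr)
    assume "\<not> length ps \<ge> 2"
    then have "set ps \<subseteq> {hd ps}" by (cases ps; cases "tl ps") auto
    then obtain p where p: "set ps \<subseteq> {p}" ..
    obtain c where "c \<in> interior C" using C(3) by blast
    then have "fits_inside C {p}" by (auto simp: fits_inside_def intro!: exI[of _ "c - p"])
    then show False using unfit p fits_inside_subset by blast
  qed
  have vertex: "ps ! i \<noteq> next_vertex ps i \<and>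
      vec_angle (prev_vertex ps i - ps ! i) (next_vertex ps i - ps ! i) \<noteq> pi \<and>
      ps ! i \<in> frontier C \<and>
      (\<exists>L H. inner_angle_bisector (prev_vertex ps i) (ps ! i) (next_vertex ps i) L \<and>
         supporting_hyperplane C H \<and> ps ! i \<in> H \<and> perpendicular L H)"
    if i: "i < length ps" for i
  proof -
    obtain qs where qs: "rotate i ps = ps ! i # qs" "qs \<noteq> []" "hd qs = next_vertex ps i"
        "last qs = prev_vertex ps i" "Suc (length qs) = length ps" "set ps = insert (ps ! i) (set qs)"
      by (rule rotate_to_vertex[OF i len])
    define p q r where "p = ps ! i" and "q = prev_vertex ps i" and "r = next_vertex ps i"
    have q: "q \<in> set qs" and r: "r \<in> set qs"
      using qs(2-4) last_in_set[OF qs(2)] hd_in_set[OF qs(2)] by (auto simp: q_def r_def)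
    have plen: "path_len ps = dist p r + open_len qs + dist q p"
      using path_len_rotate[of i ps] qs(1-4) by (simp add: path_len_Cons p_def q_def r_def)
    have fits: "fits_inside C (set qs)"
    proof (rule ccontr)
      assume "\<not> fits_inside C (set qs)"
      moreover have "path_len qs \<le> path_len ps"
        using path_len_drop_le[of qs "ps ! i"] path_len_rotate[of i ps] qs(1) by simp
      ultimately show False using assms(2) qs(5) unfolding minimal_misfit_def by force
    qed
    have unfit': "\<not> fits_inside C (insert p (set qs))" using unfit qs(6) by (simp add: p_def)
    then have pq: "p \<notin> set qs" using fits by (metis insert_absorb)
    have ne: "q \<noteq> p" "r \<noteq> p" using q r pq by auto
    have "\<not> between (q, r) p"
      using fits_inside_insert_between[OF C(1) _ q r fits] unfit' by blast
    then have angle: "vec_angle (q - p) (r - p) \<noteq> pi" using vec_angle_pi_iff_between[OF ne] by simp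
    have sub: "insert p (set qs) \<subseteq> C" using qs(6) assms(3) by (simp add: p_def)
    obtain a where a: "a \<noteq> 0" "\<And>c. c \<in> C \<Longrightarrow> a \<bullet> c \<le> a \<bullet> p"
        "\<And>x. a \<bullet> x = a \<bullet> p \<Longrightarrow> \<not> fits_inside C (insert x (set qs))"
      by (rule supporting_hyperplane_at_critical_point[OF assms(1) sub finite_set fits unfit']) blast
    have closer: "dist q p + dist p r \<le> dist q x + dist x r" if "a \<bullet> x = a \<bullet> p" for x
    proof -
      have "path_len ps \<le> path_len (x # qs)" using minimal_misfit_le[OF assms(2)] a(3)[OF that] by simp
      then show ?thesis using plen qs(2-4) by (simp add: path_len_Cons q_def r_def)
    qed
    define w where "w = sgn (q - p) + sgn (r - p)"
    have orth: "w \<bullet> z = 0" if "a \<bullet> z = 0" for z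
      unfolding w_def using reflection_law[OF ne that closer] by blast
    define H where "H = {x. a \<bullet> x = a \<bullet> p}"
    have pC: "p \<in> C" using sub by simp
    have "supporting_hyperplane C H"
      unfolding supporting_hyperplane_def H_def using a(1,2) pC by blast
    moreover have "perpendicular (halfline p w) H"
      unfolding perpendicular_def
    proof (intro ballI)
      fix x y h k assume "x \<in> halfline p w" "y \<in> halfline p w" and hk: "h \<in> H" "k \<in> H"
      then obtain s t where "x = p + s *\<^sub>R w" "y = p + t *\<^sub>R w" by (auto simp: halfline_def)
      then have "x - y = (s - t) *\<^sub>R w" by (simp add: algebra_simps)
      moreover have "w \<bullet> (h - k) = 0" using hk orth[of "h - k"] by (simp add: H_def inner_diff_right)
      ultimately show "orthogonal (x - y) (h - k)" by (simp add: orthogonal_def)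
    qed
    moreover have "inner_angle_bisector q p r (halfline p w)"
      using inner_angle_bisector_iff[OF ne angle] by (simp add: w_def)
    moreover have "p \<in> H" by (simp add: H_def)
    moreover have "p \<in> frontier C"
    proof -
      have "p \<notin> interior C"
      proof
        assume "p \<in> interior C"
        moreover have "C \<subseteq> {x. a \<bullet> x \<le> a \<bullet> p}" using a(2) by auto
        ultimately have "p \<in> interior {x. a \<bullet> x \<le> a \<bullet> p}" using interior_mono by blast
        then show False using a(1) by (simp add: interior_halfspace_le)
      qed
      then show ?thesis using pC C(2) by (simp add: frontier_def)
    qed
    ultimately have "\<exists>L H. inner_angle_bisector q p r L \<and> supporting_hyperplane C H \<and> p \<in> H
        \<and> perpendicular L H" "p \<in> frontier C" by blast+
    then show ?thesis using ne(2) angle by (simp add: p_def q_def r_def)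
  qed
  show ?thesis
    unfolding generalized_billiard_trajectory_def closed_polygonal_path_def
    using len vertex by blast
qed

section \<open>The shortest billiard trajectories\<close>

theorem theorem1p1:
  fixes C :: "'a::euclidean_space set"
  assumes "DIM('a) \<ge> 2"
    and "convex_body C"
  shows "(\<exists>ps. shortest_generalized_billiard_trajectory C ps) \<and>
         (\<forall>ps. shortest_generalized_billiard_trajectory C ps \<longrightarrow> period ps \<le> DIM('a) + 1)"
proof -
  have C: "convex C" using assms(2) by (simp add: convex_body_def)
  obtain ms where ms: "minimal_misfit C ms" by (rule exists_minimal_misfit[OF assms(2)])
  obtain y where y: "\<And>p. p \<in> set ms \<Longrightarrow> p + y \<in> C"
    by (rule minimal_misfit_fits_closed[OF assms(2) ms]) blast
  define ps where "ps = map (\<lambda>p. p + y) ms"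
  have ps: "minimal_misfit C ps" unfolding ps_def by (rule minimal_misfit_translate[OF ms])
  have gbt: "generalized_billiard_trajectory C ps"
    by (rule minimal_misfit_imp_billiard_trajectory[OF assms(2) ps]) (auto simp: ps_def y)
  have "shortest_generalized_billiard_trajectory C ps"
    unfolding shortest_generalized_billiard_trajectory_def
    using gbt minimal_misfit_le[OF ps] billiard_trajectory_not_fits[OF assms(2)] by blast
  moreover have "period qs \<le> DIM('a) + 1"
    if qs: "shortest_generalized_billiard_trajectory C qs" for qs
  proof (rule ccontr)
    assume "\<not> period qs \<le> DIM('a) + 1"
    then have long: "length qs > DIM('a) + 1" by (simp add: period_def)
    have qs_gbt: "generalized_billiard_trajectory C qs"
      using qs by (simp add: shortest_generalized_billiard_trajectory_def)
    have len: "length qs \<ge> 2" using long by simp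
    obtain i where i: "i < length qs" "\<not> fits_inside C (set (tl (rotate i qs)))"
      by (rule redundant_vertex[OF C billiard_trajectory_not_fits[OF assms(2) qs_gbt] long])
    obtain rs where rs: "rotate i qs = qs ! i # rs" "rs \<noteq> []" "hd rs = next_vertex qs i"
        "last rs = prev_vertex qs i"
      by (rule rotate_to_vertex[OF i(1) len])
    have path: "closed_polygonal_path qs"
      using qs_gbt by (simp add: generalized_billiard_trajectory_def)
    \<comment> \<open>This is where genuineness of the vertices matters: dropping one shortens the path strictly.\<close>
    have "\<not> between (last rs, hd rs) (qs ! i)"
      using neighbours_of_genuine_vertex(3)[OF path i(1)] rs(3,4) by simp
    then have "path_len rs < path_len qs"
      using path_len_drop_less[OF rs(2), of "qs ! i"] path_len_rotate[of i qs] rs(1) by simp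
    moreover have "path_len qs \<le> path_len ps"
      using qs gbt by (simp add: shortest_generalized_billiard_trajectory_def)
    moreover have "path_len ps \<le> path_len rs" using minimal_misfit_le[OF ps] i(2) rs(1) by simp
    ultimately show False by simp
  qed
  ultimately show ?thesis by blast
qed

end
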